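(* Let $L$ be a semimodular lattice of finite length and let $\mathcal F^\ast=(P,\mathcal F)$ be a geometry. Then $\mathrm{Geom}(L)$ is a geometry, $\mathrm{Lat}(\mathcal F^\ast)$ is a semimodular lattice of finite length, $\mathrm{Lat}(\mathrm{Geom}(L))\cong L$ (as lattices), and $\mathrm{Geom}(\mathrm{Lat}(\mathcal F^\ast))\cong \mathcal F^\ast$ (as geometries).
   Context: For a poset $P$ and $u\in P$, $\downarrow_P u:=\{x\in P: x\leq u\}$ and $\Downarrow_P u:=\{x\in P: x<u\}$. A down-set of $P$ is a subset $X$ with $\downarrow_P u\subseteq X$ for all $u\in X$. The length of a chain $C$ is $|C|-1$ and the length of a poset is the supremum of the lengths of its chains. A lattice is semimodular if $a\wedge b\prec a$ implies $b\prec a\vee b$. A geometry is a pair $\mathcal F^\ast=(P,\mathcal F)$ satisfying the following axioms, where $X\prec_{\mathcal F}Y$ means that $Y$ covers $X$ in the poset $(\mathcal F,\subseteq)$: (FL) $P$ is a poset, $\mathcal F$ is a set of subsets of $P$, and the poset $(\mathcal F,\subseteq)$ is of finite length. (F$\cap$) $P\in\mathcal F$, and $\bigcap\mathcal U\in\mathcal F$ for every $\mathcal U\subseteq\mathcal F$. (F$\downarrow$) Every member of $\mathcal F$ is a down-set of $P$. (Pr) $\emptyset\in\mathcal F$, and for each $u\in P$ both $\downarrow_P u$ and $\Downarrow_P u$ belong to $\mathcal F$. (CP) For any $q\in P$ and $X\in\mathcal F$ such that $q\notin X$ and $\Downarrow_P q\subseteq X$, there exists $Y\in\mathcal F$ such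 that $X\prec_{\mathcal F}Y$ and $q\in Y$. An isomorphism from a geometry $(P_1,\mathcal F_1)$ to a geometry $(P_2,\mathcal F_2)$ is a bijective map $\overline\mu\colon\mathcal F_1\to\mathcal F_2$ of the form $\overline\mu(X)=\{\mu(y):y\in X\}$, where $\mu\colon P_1\to P_2$ is a poset isomorphism. For a semimodular lattice $L$ of finite length, let $P_L$ be the poset of nonzero join-irreducible elements of $L$ (those having exactly one lower cover), with the order inherited from $L$, and let $\mathcal F_L:=\{P_L\cap\{y\in L:y\leq x\}: x\in L\}$; then $\mathrm{Geom}(L):=(P_L,\mathcal F_L)$. For a geometry $\mathcal F^\ast=(P,\mathcal F)$, $\mathrm{Lat}(\mathcal F^\ast):=(\mathcal F,\subseteq)$. *)

theory Defs
  imports "HOL-Algebra.Lattice" "HOL-Library.Extended_Nat"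
begin

definition covered_by :: "[_, 'a, 'a] \<Rightarrow> bool" (infixl \<open>\<prec>\<index>\<close> 50)
  where "x \<prec>\<^bsub>L\<^esub> y \<longleftrightarrow> x \<in> carrier L \<and> y \<in> carrier L \<and> x \<sqsubset>\<^bsub>L\<^esub> y
    \<and> \<not> (\<exists>z \<in> carrier L. x \<sqsubset>\<^bsub>L\<^esub> z \<and> z \<sqsubset>\<^bsub>L\<^esub> y)"

definition chain_length :: "'a set \<Rightarrow> enat"
  where "chain_length C = (if finite C then enat (card C - 1) else \<infinity>)"

text \<open>Only nonempty chains are considered, so the subtraction above never truncates.
  The empty poset gets length 0.\<close>

definition poset_length :: "('a, 'b) gorder_scheme \<Rightarrow> enat"
  where "poset_length L = (SUP C \<in> {C. pred_on.chain (carrier L) (le L) C \<and> C \<noteq> {}}. chain_length C)"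

definition finite_length :: "('a, 'b) gorder_scheme \<Rightarrow> bool"
  where "finite_length L \<longleftrightarrow> poset_length L < \<infinity>"

text \<open>The locale \<open>lattice\<close> admits the empty carrier; here, as usual, lattices are nonempty.\<close>

locale semimodular_lattice_finite_length = lattice L for L (structure) +
  assumes carrier_nonempty: "carrier L \<noteq> {}"
    and semimodular: "\<lbrakk>a \<in> carrier L; b \<in> carrier L; a \<sqinter> b \<prec> a\<rbrakk> \<Longrightarrow> b \<prec> a \<squnion> b"
    and finite_length: "finite_length L"

definition poset_iso :: "('a, 'c) gorder_scheme \<Rightarrow> ('b, 'd) gorder_scheme \<Rightarrow> ('a \<Rightarrow> 'b) \<Rightarrow> bool"
  where "poset_iso P Q f \<longleftrightarrow> bij_betw f (carrier P) (carrier Q) \<and> order_emb P Q f"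

definition lattice_iso :: "('a, 'c) gorder_scheme \<Rightarrow> ('b, 'd) gorder_scheme \<Rightarrow> ('a \<Rightarrow> 'b) \<Rightarrow> bool"
  where "lattice_iso L M f \<longleftrightarrow>
    bij_betw f (carrier L) (carrier M) \<and> join_pres L M f \<and> meet_pres L M f"

definition lattice_isomorphic :: "('a, 'c) gorder_scheme \<Rightarrow> ('b, 'd) gorder_scheme \<Rightarrow> bool"
  where "lattice_isomorphic L M \<longleftrightarrow> (\<exists>f. lattice_iso L M f)"

definition down :: "('a, 'b) gorder_scheme \<Rightarrow> 'a \<Rightarrow> 'a set"
  where "down P u = {x \<in> carrier P. x \<sqsubseteq>\<^bsub>P\<^esub> u}"

definition sdown :: "('a, 'b) gorder_scheme \<Rightarrow> 'a \<Rightarrow> 'a set"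
  where "sdown P u = {x \<in> carrier P. x \<sqsubset>\<^bsub>P\<^esub> u}"

definition down_set :: "('a, 'b) gorder_scheme \<Rightarrow> 'a set \<Rightarrow> bool"
  where "down_set P X \<longleftrightarrow> X \<subseteq> carrier P \<and> (\<forall>u \<in> X. down P u \<subseteq> X)"

text \<open>A pair \<open>(P, \<F>)\<close> is represented as the order record of \<open>P\<close> extended by \<open>\<F>\<close>.\<close>

record 'p geom = "'p gorder" +
  flats :: "'p set set"

definition Lat :: "('p, 'b) geom_scheme \<Rightarrow> 'p set gorder"
  where "Lat G = \<lparr>carrier = flats G, eq = (=), le = (\<subseteq>)\<rparr>"

text \<open>In \<open>Inter_flat\<close>, the intersection of the empty family of subsets of \<open>P\<close> is \<open>P\<close>.\<close>

locale geometry = partial_order G for G (structure) +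
  assumes flats_subset: "flats G \<subseteq> Pow (carrier G)"
    and finite_length_flats: "finite_length (Lat G)"
    and carrier_flat: "carrier G \<in> flats G"
    and Inter_flat: "U \<subseteq> flats G \<Longrightarrow> carrier G \<inter> \<Inter>U \<in> flats G"
    and flat_down_set: "X \<in> flats G \<Longrightarrow> down_set G X"
    and empty_flat: "{} \<in> flats G"
    and down_flat: "u \<in> carrier G \<Longrightarrow> down G u \<in> flats G"
    and sdown_flat: "u \<in> carrier G \<Longrightarrow> sdown G u \<in> flats G"
    and covering: "\<lbrakk>q \<in> carrier G; X \<in> flats G; q \<notin> X; sdown G q \<subseteq> X\<rbrakk>
      \<Longrightarrow> \<exists>Y \<in> flats G. X \<prec>\<^bsub>Lat G\<^esub> Y \<and> q \<in> Y"

text \<open>An isomorphism of geometries is a map between the families of flats.\<close>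

definition geom_iso :: "('p, 'c) geom_scheme \<Rightarrow> ('q, 'd) geom_scheme \<Rightarrow> ('p set \<Rightarrow> 'q set) \<Rightarrow> bool"
  where "geom_iso G H m \<longleftrightarrow> bij_betw m (flats G) (flats H)
    \<and> (\<exists>\<mu>. poset_iso G H \<mu> \<and> (\<forall>X \<in> flats G. m X = \<mu> ` X))"

definition geom_isomorphic :: "('p, 'c) geom_scheme \<Rightarrow> ('q, 'd) geom_scheme \<Rightarrow> bool"
  where "geom_isomorphic G H \<longleftrightarrow> (\<exists>m. geom_iso G H m)"

text \<open>The nonzero join-irreducible elements. The bottom element has no lower cover.\<close>

definition join_irreducibles :: "('a, 'b) gorder_scheme \<Rightarrow> 'a set"
  where "join_irreducibles L = {x \<in> carrier L. \<exists>!y. y \<prec>\<^bsub>L\<^esub> x}"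

definition Geom :: "('a, 'b) gorder_scheme \<Rightarrow> 'a geom"
  where "Geom L = \<lparr>carrier = join_irreducibles L, eq = (=), le = le L,
    flats = {join_irreducibles L \<inter> down L x | x. x \<in> carrier L}\<rparr>"

end

theory Submission
  imports Defs
begin

text \<open>
  The two constructions are inverse to each other because a lattice of finite length is determined
  by its join-irreducible elements: sending \<open>x\<close> to the set of join-irreducibles below \<open>x\<close> is an order
  embedding (\<open>le_if_join_irreducibles_le\<close>), so it identifies \<open>L\<close> with the flats of \<open>Geom L\<close>.
  Under this identification the covering property is semimodularity in disguise: for a
  join-irreducible \<open>q\<close> with lower cover \<open>q'\<close>, the condition that everything strictly below \<open>q\<close> lies
  in the flat of \<open>x\<close> says \<open>q' \<sqsubseteq> x\<close>; if moreover \<open>q\<close> is not below \<open>x\<close>, then \<open>q \<sqinter> x = q'\<close> is covered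
  by \<open>q\<close>, and semimodularity yields that \<open>x\<close> is covered by \<open>q \<squnion> x\<close>.

  Conversely, in a geometry let \<open>X \<inter> Y\<close> be covered by \<open>X\<close>. A minimal point \<open>q\<close> of \<open>X - Y\<close> has all
  points strictly below it in \<open>Y\<close>, so the covering property gives a flat \<open>Z\<close> that covers \<open>Y\<close> and
  contains \<open>q\<close>; then \<open>Z\<close> must contain \<open>X\<close>, and \<open>Z\<close> is the join of \<open>X\<close> and \<open>Y\<close>. So the flats form a
  semimodular lattice. Its join-irreducible elements are exactly the principal down-sets
  (\<open>join_irreducibles_Lat\<close>), since \<open>sdown G u\<close> is the largest flat strictly below \<open>down G u\<close>. A flat
  contains \<open>u\<close> iff it includes \<open>down G u\<close>, so \<open>u \<mapsto> down G u\<close> matches \<open>G\<close> with \<open>Geom (Lat G)\<close>.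

  What finite length contributes to these arguments is that nonempty subsets have minimal and
  maximal elements. This yields the minimal points and lower covers above, and it makes \<open>L\<close>
  complete, which closes the flats of \<open>Geom L\<close> under arbitrary intersections.
\<close>

section \<open>Posets of finite length\<close>

lemma finite_length_iff:
  "finite_length L \<longleftrightarrow> (\<exists>N. \<forall>C. pred_on.chain (carrier L) (le L) C \<longrightarrow> finite C \<and> card C \<le> N)"
proof
  assume "finite_length L"
  then obtain n where n: "poset_length L = enat n"
    unfolding finite_length_def by auto
  have "finite C \<and> card C \<le> Suc n" if C: "pred_on.chain (carrier L) (le L) C" for C
  proof (cases "C = {}")
    case False
    then have "chain_length C \<le> enat n"
      using C unfolding n[symmetric] poset_length_def by (intro SUP_upper) auto
    then show ?thesis
      unfolding chain_length_def by (auto split: if_splits)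
  qed simp
  then show "\<exists>N. \<forall>C. pred_on.chain (carrier L) (le L) C \<longrightarrow> finite C \<and> card C \<le> N"
    by blast
next
  assume "\<exists>N. \<forall>C. pred_on.chain (carrier L) (le L) C \<longrightarrow> finite C \<and> card C \<le> N"
  then obtain N where N: "\<And>C. pred_on.chain (carrier L) (le L) C \<Longrightarrow> finite C \<and> card C \<le> N"
    by blast
  have "chain_length C \<le> enat N" if "pred_on.chain (carrier L) (le L) C" for C
    using N[OF that] by (simp add: chain_length_def le_diff_conv)
  then have "poset_length L \<le> enat N"
    unfolding poset_length_def by (simp add: SUP_le_iff)
  then show "finite_length L"
    unfolding finite_length_def using le_less_trans by fastforce
qed

lemma finite_length_dual: "finite_length (inv_gorder L) \<longleftrightarrow> finite_length L"
proof -
  have "pred_on.chain (carrier L) (\<lambda>x y. y \<sqsubseteq>\<^bsub>L\<^esub> x) C \<longleftrightarrow> pred_on.chain (carrier L) (le L) C" for C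
    unfolding pred_on.chain_def by blast
  then show ?thesis
    unfolding finite_length_iff by simp
qed

lemma finite_length_inj:
  assumes "finite_length Q" and f: "inj_on f (carrier P)" "f ` carrier P \<subseteq> carrier Q"
    and mono: "\<And>x y. \<lbrakk>x \<in> carrier P; y \<in> carrier P; x \<sqsubseteq>\<^bsub>P\<^esub> y\<rbrakk> \<Longrightarrow> f x \<sqsubseteq>\<^bsub>Q\<^esub> f y"
  shows "finite_length P"
proof -
  obtain N where N: "\<And>C. pred_on.chain (carrier Q) (le Q) C \<Longrightarrow> finite C \<and> card C \<le> N"
    using assms(1) unfolding finite_length_iff by blast
  have "finite C \<and> card C \<le> N" if C: "pred_on.chain (carrier P) (le P) C" for C
  proof -
    have "pred_on.chain (carrier Q) (le Q) (f ` C)"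
      using C f(2) mono unfolding pred_on.chain_def by (auto simp: subset_iff) metis
    then have "finite (f ` C) \<and> card (f ` C) \<le> N"
      by (rule N)
    moreover have "inj_on f C"
      using C f(1) unfolding pred_on.chain_def by (auto intro: inj_on_subset)
    ultimately show ?thesis
      by (simp add: card_image finite_image_iff)
  qed
  then show ?thesis
    unfolding finite_length_iff by blast
qed

lemma (in partial_order) finite_chain_has_greatest:
  assumes "finite C" "C \<noteq> {}" "pred_on.chain (carrier L) (le L) C"
  shows "\<exists>m\<in>C. \<forall>c\<in>C. c \<sqsubseteq> m"
  using assms
proof (induction rule: finite_ne_induct)
  case (singleton x)
  then show ?case
    by (auto simp: pred_on.chain_def)
next
  case (insert x F)
  then obtain m where m: "m \<in> F" "\<forall>c\<in>F. c \<sqsubseteq> m"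
    by (auto simp: pred_on.chain_def)
  have carr: "insert x F \<subseteq> carrier L" and tot: "x \<sqsubseteq> m \<or> m \<sqsubseteq> x"
    using insert.prems m(1) by (auto simp: pred_on.chain_def)
  show ?case
  proof (cases "x \<sqsubseteq> m")
    case False
    with tot have "\<forall>c\<in>F. c \<sqsubseteq> x"
      using m carr le_trans by (meson insert_subset subsetD)
    with carr show ?thesis
      by auto
  qed (use m in auto)
qed

text \<open>The greatest element of a chain in \<open>S\<close> of maximal size is maximal in \<open>S\<close>: an element of \<open>S\<close>
  strictly above it would extend the chain.\<close>

lemma (in partial_order) maximal_exists:
  assumes "finite_length L" and S: "S \<subseteq> carrier L" "S \<noteq> {}"
  shows "\<exists>m\<in>S. \<forall>s\<in>S. m \<sqsubseteq> s \<longrightarrow> s = m"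
proof -
  let ?chain = "\<lambda>C. pred_on.chain (carrier L) (le L) C \<and> C \<subseteq> S \<and> C \<noteq> {}"
  obtain N where N: "\<And>C. pred_on.chain (carrier L) (le L) C \<Longrightarrow> finite C \<and> card C \<le> N"
    using assms(1) unfolding finite_length_iff by blast
  obtain x where x: "x \<in> S"
    using S by blast
  then have "?chain {x}"
    using S by (auto simp: pred_on.chain_def)
  moreover have "\<forall>D. ?chain D \<longrightarrow> card D < Suc N"
    using N by (simp add: less_Suc_eq_le)
  ultimately have "\<exists>C. ?chain C \<and> (\<forall>D. ?chain D \<longrightarrow> card D \<le> card C)"
    by (rule ex_has_greatest_nat[of ?chain "{x}" card "Suc N"])
  then obtain C where C: "?chain C" and C_max: "\<And>D. ?chain D \<Longrightarrow> card D \<le> card C"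
    by (elim exE conjE) simp
  have C_fin: "finite C"
    using N C by simp
  then obtain m where m: "m \<in> C" "\<forall>c\<in>C. c \<sqsubseteq> m"
    using finite_chain_has_greatest[of C] C by auto
  have "s = m" if s: "s \<in> S" "m \<sqsubseteq> s" for s
  proof (rule ccontr)
    assume "s \<noteq> m"
    have CS: "C \<subseteq> carrier L" and sL: "s \<in> carrier L"
      using C S s by auto
    have below: "\<forall>c\<in>C. c \<sqsubseteq> s"
      using m s CS sL le_trans by (meson subsetD)
    have "s \<notin> C"
      using \<open>s \<noteq> m\<close> m s CS sL le_antisym by (meson subsetD)
    have "?chain (insert s C)"
      using C below s sL by (auto simp: pred_on.chain_def)
    then have "card (insert s C) \<le> card C"
      by (rule C_max)
    with \<open>s \<notin> C\<close> C_fin show False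
      by simp
  qed
  with m C show ?thesis
    by blast
qed

lemma (in partial_order) minimal_exists:
  assumes "finite_length L" and S: "S \<subseteq> carrier L" "S \<noteq> {}"
  shows "\<exists>m\<in>S. \<forall>s\<in>S. s \<sqsubseteq> m \<longrightarrow> s = m"
proof -
  interpret dual: partial_order "inv_gorder L"
    by (rule dual_order)
  show ?thesis
    using dual.maximal_exists[of S] assms by (simp add: finite_length_dual)
qed

lemma (in partial_order) lower_cover_above_exists:
  assumes "finite_length L" and x: "x \<in> carrier L" and y: "y \<in> carrier L" and xy: "x \<sqsubset> y"
  shows "\<exists>z. z \<prec> y \<and> x \<sqsubseteq> z"
proof -
  let ?S = "{z \<in> carrier L. x \<sqsubseteq> z \<and> z \<sqsubset> y}"
  have "?S \<subseteq> carrier L" "?S \<noteq> {}"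
    using x xy by auto
  then obtain z where z: "z \<in> ?S" and z_max: "\<And>s. \<lbrakk>s \<in> ?S; z \<sqsubseteq> s\<rbrakk> \<Longrightarrow> s = z"
    using maximal_exists[OF assms(1)] by meson
  have "\<not> (z \<sqsubset> w \<and> w \<sqsubset> y)" if w: "w \<in> carrier L" for w
    using z_max[of w] z w x le_trans by (auto simp: lless_eq)
  with z y show ?thesis
    unfolding covered_by_def by blast
qed

section \<open>Isomorphisms of posets\<close>

lemma poset_iso_inv:
  assumes "poset_iso P Q f"
  shows "poset_iso Q P (inv_into (carrier P) f)"
proof -
  have bij: "bij_betw f (carrier P) (carrier Q)"
    and le: "\<And>x y. \<lbrakk>x \<in> carrier P; y \<in> carrier P\<rbrakk> \<Longrightarrow> f x \<sqsubseteq>\<^bsub>Q\<^esub> f y \<longleftrightarrow> x \<sqsubseteq>\<^bsub>P\<^esub> y"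
    using assms unfolding poset_iso_def order_emb_def by auto
  have "inv_into (carrier P) f x \<sqsubseteq>\<^bsub>P\<^esub> inv_into (carrier P) f y \<longleftrightarrow> x \<sqsubseteq>\<^bsub>Q\<^esub> y"
    if "x \<in> carrier Q" "y \<in> carrier Q" for x y
    using le[of "inv_into (carrier P) f x" "inv_into (carrier P) f y"] that bij
    by (simp add: bij_betw_def inv_into_into f_inv_into_f)
  then show ?thesis
    using assms bij_betw_inv_into[OF bij] unfolding poset_iso_def order_emb_def by blast
qed

lemma finite_length_poset_iso:
  assumes "poset_iso P Q f" "finite_length P"
  shows "finite_length Q"
  using finite_length_inj[OF assms(2), of "inv_into (carrier P) f" Q] poset_iso_inv[OF assms(1)]
  unfolding poset_iso_def order_emb_def by (auto simp: bij_betw_def)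

lemma covered_by_poset_iso:
  assumes iso: "poset_iso P Q f" and "partial_order P" "partial_order Q" and cov: "x \<prec>\<^bsub>P\<^esub> y"
  shows "f x \<prec>\<^bsub>Q\<^esub> f y"
proof -
  interpret P: partial_order P by fact
  interpret Q: partial_order Q by fact
  have bij: "bij_betw f (carrier P) (carrier Q)"
    and le: "\<And>x y. \<lbrakk>x \<in> carrier P; y \<in> carrier P\<rbrakk> \<Longrightarrow> f x \<sqsubseteq>\<^bsub>Q\<^esub> f y \<longleftrightarrow> x \<sqsubseteq>\<^bsub>P\<^esub> y"
    using iso unfolding poset_iso_def order_emb_def by auto
  have less: "f u \<sqsubset>\<^bsub>Q\<^esub> f v \<longleftrightarrow> u \<sqsubset>\<^bsub>P\<^esub> v" if "u \<in> carrier P" "v \<in> carrier P" for u v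
    using that le bij by (auto simp: P.lless_eq Q.lless_eq bij_betw_def inj_on_eq_iff)
  have img: "carrier Q = f ` carrier P"
    using bij by (simp add: bij_betw_def)
  show ?thesis
    using cov unfolding covered_by_def img by (auto simp: less)
qed

text \<open>Joins and meets are determined by the order, so an order isomorphism preserves them.\<close>

lemma lattice_iso_poset_iso:
  assumes iso: "poset_iso L M f" and "lattice L" "lattice M"
  shows "lattice_iso L M f"
proof -
  interpret L: lattice L by fact
  interpret M: lattice M by fact
  have bij: "bij_betw f (carrier L) (carrier M)"
    and le: "\<And>x y. \<lbrakk>x \<in> carrier L; y \<in> carrier L\<rbrakk> \<Longrightarrow> f x \<sqsubseteq>\<^bsub>M\<^esub> f y \<longleftrightarrow> x \<sqsubseteq>\<^bsub>L\<^esub> y"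
    using iso unfolding poset_iso_def order_emb_def by auto
  have closed: "\<And>x. x \<in> carrier L \<Longrightarrow> f x \<in> carrier M"
    using bij by (auto simp: bij_betw_def)
  have preimage: "\<exists>z\<in>carrier L. w = f z" if "w \<in> carrier M" for w
    using bij that by (auto simp: bij_betw_def)
  have "f (x \<squnion>\<^bsub>L\<^esub> y) = f x \<squnion>\<^bsub>M\<^esub> f y" if xy: "x \<in> carrier L" "y \<in> carrier L" for x y
  proof (rule M.le_antisym)
    obtain z where z: "z \<in> carrier L" "f x \<squnion>\<^bsub>M\<^esub> f y = f z"
      using preimage xy closed by (metis M.join_closed)
    have "x \<sqsubseteq>\<^bsub>L\<^esub> z" "y \<sqsubseteq>\<^bsub>L\<^esub> z"
      using M.join_left M.join_right xy closed z le by metis+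
    then show "f (x \<squnion>\<^bsub>L\<^esub> y) \<sqsubseteq>\<^bsub>M\<^esub> f x \<squnion>\<^bsub>M\<^esub> f y"
      unfolding z(2) using le xy z L.join_le by simp
    show "f x \<squnion>\<^bsub>M\<^esub> f y \<sqsubseteq>\<^bsub>M\<^esub> f (x \<squnion>\<^bsub>L\<^esub> y)"
      using xy by (intro M.join_le) (auto simp: le closed L.join_left L.join_right)
  qed (simp_all add: closed xy)
  moreover have "f (x \<sqinter>\<^bsub>L\<^esub> y) = f x \<sqinter>\<^bsub>M\<^esub> f y" if xy: "x \<in> carrier L" "y \<in> carrier L" for x y
  proof (rule M.le_antisym)
    obtain z where z: "z \<in> carrier L" "f x \<sqinter>\<^bsub>M\<^esub> f y = f z"
      using preimage xy closed by (metis M.meet_closed)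
    have "z \<sqsubseteq>\<^bsub>L\<^esub> x" "z \<sqsubseteq>\<^bsub>L\<^esub> y"
      using M.meet_left M.meet_right xy closed z le by metis+
    then show "f x \<sqinter>\<^bsub>M\<^esub> f y \<sqsubseteq>\<^bsub>M\<^esub> f (x \<sqinter>\<^bsub>L\<^esub> y)"
      unfolding z(2) using le xy z L.meet_le by simp
    show "f (x \<sqinter>\<^bsub>L\<^esub> y) \<sqsubseteq>\<^bsub>M\<^esub> f x \<sqinter>\<^bsub>M\<^esub> f y"
      using xy by (intro M.meet_le) (auto simp: le closed L.meet_left L.meet_right)
  qed (simp_all add: closed xy)
  ultimately show ?thesis
    using bij assms(2,3) unfolding lattice_iso_def join_pres_def meet_pres_def by blast
qed

section \<open>The lattice of flats of a geometry\<close>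

lemma Lat_simps [simp]:
  "carrier (Lat G) = flats G" "(.=\<^bsub>Lat G\<^esub>) = (=)" "(\<sqsubseteq>\<^bsub>Lat G\<^esub>) = (\<subseteq>)"
  by (simp_all add: Lat_def)

lemma partial_order_Lat: "partial_order (Lat G)"
  by unfold_locales auto

lemma lless_Lat [simp]: "X \<sqsubset>\<^bsub>Lat G\<^esub> Y \<longleftrightarrow> X \<subset> Y"
  by (auto simp: lless_def)

lemma covered_by_Lat:
  "X \<prec>\<^bsub>Lat G\<^esub> Y \<longleftrightarrow> X \<in> flats G \<and> Y \<in> flats G \<and> X \<subset> Y \<and> \<not> (\<exists>Z\<in>flats G. X \<subset> Z \<and> Z \<subset> Y)"
  by (simp add: covered_by_def)

context geometry
begin

lemma flat_Int:
  assumes "X \<in> flats G" "Y \<in> flats G"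
  shows "X \<inter> Y \<in> flats G"
proof -
  have "carrier G \<inter> \<Inter>{X, Y} = X \<inter> Y"
    using flats_subset assms by auto
  then show ?thesis
    using Inter_flat[of "{X, Y}"] assms by simp
qed

lemma lattice_Lat: "lattice (Lat G)"
proof -
  interpret F: partial_order "Lat G"
    by (rule partial_order_Lat)
  show ?thesis
  proof unfold_locales
    fix X Y
    assume XY: "X \<in> carrier (Lat G)" "Y \<in> carrier (Lat G)"
    let ?J = "carrier G \<inter> \<Inter>{Z \<in> flats G. X \<subseteq> Z \<and> Y \<subseteq> Z}"
    have "?J \<in> flats G"
      by (rule Inter_flat) auto
    then have "least (Lat G) ?J (Upper (Lat G) {X, Y})"
      using XY flats_subset by (intro least_UpperI) (auto simp: Upper_def)
    then show "\<exists>s. least (Lat G) s (Upper (Lat G) {X, Y})" ..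
    have "greatest (Lat G) (X \<inter> Y) (Lower (Lat G) {X, Y})"
      using XY flat_Int by (intro greatest_LowerI) (auto simp: Lower_def)
    then show "\<exists>s. greatest (Lat G) s (Lower (Lat G) {X, Y})" ..
  qed
qed

lemma meet_Lat:
  assumes "X \<in> flats G" "Y \<in> flats G"
  shows "X \<sqinter>\<^bsub>Lat G\<^esub> Y = X \<inter> Y"
proof -
  interpret F: lattice "Lat G"
    by (rule lattice_Lat)
  show ?thesis
    using F.meet_left[of X Y] F.meet_right[of X Y] F.meet_le[of "X \<inter> Y" X Y] assms flat_Int[OF assms]
    by auto
qed

lemma in_down_self: "u \<in> carrier G \<Longrightarrow> u \<in> down G u"
  by (simp add: down_def)

lemma mem_flat_iff_down_subset:
  "\<lbrakk>X \<in> flats G; u \<in> carrier G\<rbrakk> \<Longrightarrow> u \<in> X \<longleftrightarrow> down G u \<subseteq> X"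
  using flat_down_set[of X] in_down_self[of u] unfolding down_set_def by blast

lemma down_subset_iff:
  "\<lbrakk>u \<in> carrier G; v \<in> carrier G\<rbrakk> \<Longrightarrow> down G u \<subseteq> down G v \<longleftrightarrow> u \<sqsubseteq> v"
  using mem_flat_iff_down_subset[OF down_flat[of v], of u] by (simp add: down_def)

text \<open>The map \<open>u \<mapsto> down G u\<close> embeds the points into the flats, so the poset of points has finite
  length as well.\<close>

lemma minimal_point_exists:
  assumes S: "S \<subseteq> carrier G" "S \<noteq> {}"
  shows "\<exists>q\<in>S. \<forall>s\<in>S. s \<sqsubseteq> q \<longrightarrow> s = q"
proof -
  have "inj_on (down G) (carrier G)"
    using down_subset_iff by (intro inj_onI) (blast intro: le_antisym)
  then have "finite_length G"
  proof (rule finite_length_inj[OF finite_length_flats])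
    show "down G ` carrier G \<subseteq> carrier (Lat G)"
      using down_flat by auto
  qed (simp add: down_subset_iff)
  then show ?thesis
    using minimal_exists S by blast
qed

lemma semimodular_Lat:
  assumes X: "X \<in> flats G" and Y: "Y \<in> flats G" and cov: "X \<inter> Y \<prec>\<^bsub>Lat G\<^esub> X"
  shows "Y \<prec>\<^bsub>Lat G\<^esub> X \<squnion>\<^bsub>Lat G\<^esub> Y"
proof -
  interpret F: lattice "Lat G"
    by (rule lattice_Lat)
  have not_sub: "\<not> X \<subseteq> Y"
    using cov unfolding covered_by_Lat by blast
  have "X - Y \<subseteq> carrier G" "X - Y \<noteq> {}"
    using not_sub X flats_subset by auto
  then obtain q where q: "q \<in> X - Y" and q_min: "\<And>s. \<lbrakk>s \<in> X - Y; s \<sqsubseteq> q\<rbrakk> \<Longrightarrow> s = q"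
    using minimal_point_exists by meson
  have qG: "q \<in> carrier G"
    using q X flats_subset by auto
  have "sdown G q \<subseteq> Y"
  proof
    fix s
    assume s: "s \<in> sdown G q"
    then have "s \<in> X" "s \<sqsubseteq> q" "s \<noteq> q"
      using q flat_down_set[OF X] by (auto simp: sdown_def down_set_def down_def lless_eq)
    with q_min show "s \<in> Y"
      by blast
  qed
  then obtain Z where Z: "Z \<in> flats G" "Y \<prec>\<^bsub>Lat G\<^esub> Z" "q \<in> Z"
    using covering qG Y q by blast
  \<comment> \<open>\<open>X \<inter> Z\<close> lies strictly above \<open>X \<inter> Y\<close> because it contains \<open>q\<close>, so the cover forces it to be \<open>X\<close>.\<close>
  have "X \<inter> Y \<subset> X \<inter> Z"
    using Z q unfolding covered_by_Lat by blast
  then have "X \<subseteq> Z"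
    using cov flat_Int[OF X Z(1)] unfolding covered_by_Lat by blast
  have J: "X \<squnion>\<^bsub>Lat G\<^esub> Y \<in> flats G" "X \<subseteq> X \<squnion>\<^bsub>Lat G\<^esub> Y" "Y \<subseteq> X \<squnion>\<^bsub>Lat G\<^esub> Y"
    using F.join_closed[of X Y] F.join_left[of X Y] F.join_right[of X Y] X Y by auto
  have "X \<squnion>\<^bsub>Lat G\<^esub> Y \<subseteq> Z"
    using F.join_le[of X Z Y] X Y Z \<open>X \<subseteq> Z\<close> unfolding covered_by_Lat by auto
  then have "X \<squnion>\<^bsub>Lat G\<^esub> Y = Z"
    using Z(2) J not_sub unfolding covered_by_Lat by blast
  with Z show ?thesis
    by simp
qed

lemma semimodular_lattice_Lat: "semimodular_lattice_finite_length (Lat G)"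
proof -
  interpret F: lattice "Lat G"
    by (rule lattice_Lat)
  show ?thesis
    using empty_flat finite_length_flats semimodular_Lat
    by unfold_locales (auto simp: meet_Lat)
qed

section \<open>Recovering a geometry from its lattice of flats\<close>

text \<open>A flat strictly inside \<open>down G u\<close> misses \<open>u\<close>, so it lies in \<open>sdown G u\<close>, which is itself a
  flat.\<close>

lemma covered_by_down_iff:
  assumes u: "u \<in> carrier G"
  shows "Y \<prec>\<^bsub>Lat G\<^esub> down G u \<longleftrightarrow> Y = sdown G u"
proof -
  have sdown: "sdown G u \<in> flats G" "sdown G u \<subset> down G u"
    using sdown_flat[OF u] u by (auto simp: sdown_def down_def lless_eq)
  have below: "Z \<subseteq> sdown G u" if "Z \<in> flats G" "Z \<subset> down G u" for Z
    using mem_flat_iff_down_subset[OF that(1) u] that(2) by (auto simp: sdown_def down_def lless_eq)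
  show ?thesis
    using sdown below down_flat[OF u] unfolding covered_by_Lat by blast
qed

lemma join_irreducibles_Lat: "join_irreducibles (Lat G) = down G ` carrier G"
proof
  show "down G ` carrier G \<subseteq> join_irreducibles (Lat G)"
    using down_flat by (auto simp: join_irreducibles_def covered_by_down_iff)
  show "join_irreducibles (Lat G) \<subseteq> down G ` carrier G"
  proof
    fix X
    assume "X \<in> join_irreducibles (Lat G)"
    then obtain Y where X: "X \<in> flats G" and Y: "Y \<prec>\<^bsub>Lat G\<^esub> X"
      and Y_unique: "\<And>Z. Z \<prec>\<^bsub>Lat G\<^esub> X \<Longrightarrow> Z = Y"
      by (auto simp: join_irreducibles_def)
    obtain q where q: "q \<in> X" "q \<notin> Y"
      using Y unfolding covered_by_Lat by blast
    have qG: "q \<in> carrier G"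
      using q X flats_subset by auto
    have sub: "down G q \<subseteq> X"
      using mem_flat_iff_down_subset X qG q by blast
    \<comment> \<open>Otherwise \<open>down G q\<close> would lie below the only lower cover \<open>Y\<close>, which misses \<open>q\<close>.\<close>
    have "down G q = X"
    proof (rule ccontr)
      assume "down G q \<noteq> X"
      then obtain Z where "Z \<prec>\<^bsub>Lat G\<^esub> X" "down G q \<subseteq> Z"
        using partial_order.lower_cover_above_exists[OF partial_order_Lat finite_length_flats, of "down G q" X]
          sub down_flat[OF qG] X by auto
      then show False
        using Y_unique in_down_self[OF qG] q by blast
    qed
    with qG show "X \<in> down G ` carrier G"
      by blast
  qed
qed

lemma join_irreducibles_below_flat:
  assumes X: "X \<in> flats G"
  shows "join_irreducibles (Lat G) \<inter> down (Lat G) X = down G ` X"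
proof -
  have "X \<subseteq> carrier G"
    using X flats_subset by auto
  then show ?thesis
    using mem_flat_iff_down_subset[OF X] down_flat
    by (auto simp: join_irreducibles_Lat down_def[of "Lat G"])
qed

lemma Geom_Lat_isomorphic: "geom_isomorphic (Geom (Lat G)) G"
proof -
  let ?H = "Geom (Lat G)"
  let ?\<mu> = "inv_into (carrier G) (down G)"
  interpret H: weak_partial_order ?H
    by unfold_locales (auto simp: Geom_def)
  have inj: "inj_on (down G) (carrier G)"
    using down_subset_iff by (intro inj_onI) (blast intro: le_antisym)
  have carrier_H: "carrier ?H = down G ` carrier G"
    by (simp add: Geom_def join_irreducibles_Lat)
  have "flats ?H = (\<lambda>X. join_irreducibles (Lat G) \<inter> down (Lat G) X) ` flats G"
    by (auto simp: Geom_def)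
  also have "\<dots> = (`) (down G) ` flats G"
    by (intro image_cong) (simp_all add: join_irreducibles_below_flat)
  finally have flats_H: "flats ?H = (`) (down G) ` flats G" .
  have le_H: "(\<sqsubseteq>\<^bsub>?H\<^esub>) = (\<subseteq>)"
    by (simp add: Geom_def)
  have "poset_iso G ?H (down G)"
    using inj down_subset_iff weak_partial_order_axioms H.weak_partial_order_axioms
    by (simp add: poset_iso_def order_emb_def bij_betw_def carrier_H le_H)
  then have "poset_iso ?H G ?\<mu>"
    by (rule poset_iso_inv)
  moreover
  have image: "?\<mu> ` down G ` X = X" if "X \<in> flats G" for X
    using that flats_subset inj by (intro inv_into_image_cancel) auto
  then have "bij_betw ((`) ?\<mu>) (flats ?H) (flats G)"
    unfolding flats_H
  proof (intro bij_betwI[where g = "(`) (down G)"])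
    show "down G ` ?\<mu> ` Y = Y" if "Y \<in> (`) (down G) ` flats G" for Y
      using that image by (elim imageE) simp
  qed (use image in auto)
  ultimately show ?thesis
    unfolding geom_isomorphic_def geom_iso_def by blast
qed

end

section \<open>The geometry of a semimodular lattice\<close>

context semimodular_lattice_finite_length
begin

abbreviation irreducibles_below :: "'a \<Rightarrow> 'a set"
  where "irreducibles_below x \<equiv> join_irreducibles L \<inter> down L x"

text \<open>The set of lower bounds of \<open>A\<close> is closed under joins, so a maximal one is the greatest.\<close>

lemma glb_exists:
  assumes A: "A \<subseteq> carrier L" and bound: "b \<in> Lower L A"
  shows "\<exists>m. greatest L m (Lower L A)"
proof -
  obtain m where m: "m \<in> Lower L A" and m_max: "\<And>s. \<lbrakk>s \<in> Lower L A; m \<sqsubseteq> s\<rbrakk> \<Longrightarrow> s = m"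
    using maximal_exists[OF finite_length Lower_closed, of A] bound by blast
  have "s \<sqsubseteq> m" if s: "s \<in> Lower L A" for s
  proof -
    have carr: "s \<in> carrier L" "m \<in> carrier L"
      using s m by (simp_all add: Lower_def)
    have "s \<squnion> m \<in> Lower L A"
      using s m A carr by (auto simp: Lower_def intro!: join_le)
    then have "s \<squnion> m = m"
      using m_max carr by (simp add: join_right)
    then show ?thesis
      using join_left carr by metis
  qed
  with m show ?thesis
    unfolding greatest_def by blast
qed

lemma bottom_element: "\<exists>b\<in>carrier L. \<forall>x\<in>carrier L. b \<sqsubseteq> x"
proof -
  obtain b where b: "b \<in> carrier L" and b_min: "\<And>s. \<lbrakk>s \<in> carrier L; s \<sqsubseteq> b\<rbrakk> \<Longrightarrow> s = b"
    using minimal_exists[OF finite_length, of "carrier L"] carrier_nonempty by blast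
  have "b \<sqsubseteq> x" if "x \<in> carrier L" for x
    using b_min[of "b \<sqinter> x"] meet_left[of b x] meet_right[of b x] b that by auto
  with b show ?thesis
    by blast
qed

text \<open>A minimal counterexample \<open>z\<close> has a lower cover, because \<open>z \<sqinter> y\<close> is strictly below it, and it
  is not join-irreducible itself, so it has two. By minimality both lie below \<open>y\<close>, and hence so does
  their join; but the join of two distinct lower covers of \<open>z\<close> is \<open>z\<close>.\<close>

lemma le_if_join_irreducibles_le:
  assumes x: "x \<in> carrier L" and y: "y \<in> carrier L"
    and sub: "irreducibles_below x \<subseteq> down L y"
  shows "x \<sqsubseteq> y"
proof (rule ccontr)
  assume "\<not> x \<sqsubseteq> y"
  let ?S = "{z \<in> carrier L. irreducibles_below z \<subseteq> down L y \<and> \<not> z \<sqsubseteq> y}"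
  have "?S \<subseteq> carrier L" "?S \<noteq> {}"
    using x sub \<open>\<not> x \<sqsubseteq> y\<close> by auto
  then obtain z where z: "z \<in> ?S" and z_min: "\<And>s. \<lbrakk>s \<in> ?S; s \<sqsubseteq> z\<rbrakk> \<Longrightarrow> s = z"
    using minimal_exists[OF finite_length] by meson
  have zL: "z \<in> carrier L"
    using z by blast
  have below: "w \<sqsubseteq> y" if w: "w \<in> carrier L" "w \<sqsubset> z" for w
  proof -
    have "down L w \<subseteq> down L z"
      using w zL le_trans by (auto simp: down_def lless_eq)
    then show ?thesis
      using z_min[of w] z w by (auto simp: lless_eq)
  qed
  have "\<not> z \<sqsubseteq> y"
    using z by blast
  have "z \<notin> join_irreducibles L"
    using z by (auto simp: down_def)
  have "z \<sqinter> y \<sqsubset> z"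
    using meet_left[of z y] meet_right[of z y] zL y \<open>\<not> z \<sqsubseteq> y\<close> by (auto simp: lless_eq)
  then obtain a where a: "a \<prec> z"
    using lower_cover_above_exists[OF finite_length meet_closed[OF zL y] zL] by blast
  with \<open>z \<notin> join_irreducibles L\<close> zL obtain b where b: "b \<prec> z" "b \<noteq> a"
    unfolding join_irreducibles_def by blast
  have carr: "a \<in> carrier L" "b \<in> carrier L" and less: "a \<sqsubset> z" "b \<sqsubset> z"
    using a b unfolding covered_by_def by auto
  have "a \<squnion> b \<sqsubseteq> z"
    using carr less zL by (intro join_le) (auto simp: lless_eq)
  moreover have "a \<squnion> b \<noteq> z"
    using below[of a] below[of b] join_le[of a y b] carr less y \<open>\<not> z \<sqsubseteq> y\<close> by auto
  ultimately have "a \<squnion> b \<sqsubset> z"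
    by (simp add: lless_eq)
  \<comment> \<open>A lower cover of \<open>z\<close> has no elements between it and \<open>z\<close>, so both \<open>a\<close> and \<open>b\<close> equal \<open>a \<squnion> b\<close>.\<close>
  then have "a = a \<squnion> b" "b = a \<squnion> b"
    using a b carr join_left[of a b] join_right[of a b] unfolding covered_by_def
    by (auto simp: lless_eq)
  with b show False
    by simp
qed

lemma irreducibles_below_subset_iff:
  assumes "x \<in> carrier L" "y \<in> carrier L"
  shows "irreducibles_below x \<subseteq> irreducibles_below y \<longleftrightarrow> x \<sqsubseteq> y"
proof
  assume "irreducibles_below x \<subseteq> irreducibles_below y"
  then show "x \<sqsubseteq> y"
    using le_if_join_irreducibles_le assms by blast
next
  assume "x \<sqsubseteq> y"
  then show "irreducibles_below x \<subseteq> irreducibles_below y"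
    using assms le_trans by (auto simp: down_def)
qed

lemma carrier_Geom: "carrier (Geom L) = join_irreducibles L"
  and flats_Geom: "flats (Geom L) = irreducibles_below ` carrier L"
  by (auto simp: Geom_def)

lemma poset_iso_Lat_Geom: "poset_iso L (Lat (Geom L)) irreducibles_below"
proof -
  have "inj_on irreducibles_below (carrier L)"
    using irreducibles_below_subset_iff by (intro inj_onI) (blast intro: le_antisym)
  then show ?thesis
    using partial_order.axioms(1)[OF partial_order_Lat] weak_partial_order_axioms
      irreducibles_below_subset_iff
    by (simp add: poset_iso_def order_emb_def bij_betw_def flats_Geom)
qed

lemma Int_Inter_flat_Geom:
  assumes "U \<subseteq> flats (Geom L)"
  shows "join_irreducibles L \<inter> \<Inter>U \<in> flats (Geom L)"
proof -
  obtain A where A: "A \<subseteq> carrier L" "U = irreducibles_below ` A"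
    using assms unfolding flats_Geom by (rule subset_imageE)
  obtain b where "b \<in> carrier L" "\<forall>x\<in>carrier L. b \<sqsubseteq> x"
    using bottom_element by blast
  then have "b \<in> Lower L A"
    by (auto simp: Lower_def)
  then obtain m where m: "greatest L m (Lower L A)"
    using glb_exists A(1) by blast
  have mL: "m \<in> carrier L" and m_le: "\<And>a. a \<in> A \<Longrightarrow> m \<sqsubseteq> a"
    using m A(1) by (auto intro: greatest_Lower_below)
  have "join_irreducibles L \<inter> \<Inter>U = irreducibles_below m"
  proof
    show "irreducibles_below m \<subseteq> join_irreducibles L \<inter> \<Inter>U"
      unfolding A(2) using irreducibles_below_subset_iff[OF mL] m_le A(1) by blast
    show "join_irreducibles L \<inter> \<Inter>U \<subseteq> irreducibles_below m"
    proof
      fix p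
      assume p: "p \<in> join_irreducibles L \<inter> \<Inter>U"
      then have "p \<in> carrier L"
        by (simp add: join_irreducibles_def)
      moreover have "p \<in> irreducibles_below a" if "a \<in> A" for a
        using p that unfolding A(2) by blast
      then have "p \<in> Lower L A"
        using \<open>p \<in> carrier L\<close> by (auto simp: Lower_def down_def)
      ultimately show "p \<in> irreducibles_below m"
        using p greatest_le[OF m] by (auto simp: down_def)
    qed
  qed
  with mL show ?thesis
    by (simp add: flats_Geom)
qed

lemma less_join_irreducible_iff:
  assumes q: "q \<in> join_irreducibles L" and q': "q' \<prec> q" and x: "x \<in> carrier L"
  shows "x \<sqsubset> q \<longleftrightarrow> x \<sqsubseteq> q'"
proof
  have carr: "q \<in> carrier L" "q' \<in> carrier L" and less: "q' \<sqsubset> q"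
    using q' by (auto simp: covered_by_def)
  show "x \<sqsubset> q \<Longrightarrow> x \<sqsubseteq> q'"
    using lower_cover_above_exists[OF finite_length x carr(1)] q q'
    unfolding join_irreducibles_def by blast
  show "x \<sqsubset> q" if "x \<sqsubseteq> q'"
    using that less x carr le_trans le_antisym unfolding lless_eq by blast
qed

lemma partial_order_Geom: "partial_order (Geom L)"
  by unfold_locales (auto simp: Geom_def join_irreducibles_def intro: le_antisym le_trans)

lemma down_Geom: "down (Geom L) u = irreducibles_below u"
  by (auto simp: Geom_def down_def join_irreducibles_def)

lemma sdown_Geom:
  assumes "q \<in> join_irreducibles L" "q' \<prec> q"
  shows "sdown (Geom L) q = irreducibles_below q'"
proof -
  have "x \<sqsubset>\<^bsub>Geom L\<^esub> q \<longleftrightarrow> x \<sqsubset> q" for x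
    by (simp add: Geom_def lless_def eq_is_equal)
  then show ?thesis
    using less_join_irreducible_iff[OF assms]
    by (auto simp: carrier_Geom sdown_def down_def join_irreducibles_def)
qed

lemma geometry_Geom: "geometry (Geom L)"
proof -
  interpret P: partial_order "Geom L"
    by (rule partial_order_Geom)
  have lower_cover: "\<exists>q'. q' \<prec> q \<and> q' \<in> carrier L" if "q \<in> join_irreducibles L" for q
    using that by (auto simp: join_irreducibles_def covered_by_def)
  show ?thesis
  proof unfold_locales
    show "flats (Geom L) \<subseteq> Pow (carrier (Geom L))"
      by (auto simp: flats_Geom carrier_Geom)
    show "finite_length (Lat (Geom L))"
      by (rule finite_length_poset_iso[OF poset_iso_Lat_Geom finite_length])
    show "carrier (Geom L) \<in> flats (Geom L)"
      using Int_Inter_flat_Geom[of "{}"] by (simp add: carrier_Geom)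
    show "carrier (Geom L) \<inter> \<Inter>U \<in> flats (Geom L)" if "U \<subseteq> flats (Geom L)" for U
      using Int_Inter_flat_Geom that by (simp add: carrier_Geom)
    show "down_set (Geom L) X" if "X \<in> flats (Geom L)" for X
      using that irreducibles_below_subset_iff
      by (auto simp: flats_Geom down_set_def carrier_Geom down_Geom)
        (auto simp: down_def join_irreducibles_def intro: le_trans)
    show "{} \<in> flats (Geom L)"
    proof -
      obtain b where b: "b \<in> carrier L" "\<forall>x\<in>carrier L. b \<sqsubseteq> x"
        using bottom_element by blast
      have "p \<notin> join_irreducibles L" if "p \<sqsubseteq> b" "p \<in> carrier L" for p
      proof
        assume "p \<in> join_irreducibles L"
        then obtain p' where "p' \<sqsubset> p" "p' \<in> carrier L"
          by (auto simp: join_irreducibles_def covered_by_def)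
        then show False
          using b that le_trans le_antisym unfolding lless_eq by blast
      qed
      then have "irreducibles_below b = {}"
        by (auto simp: down_def)
      with b show ?thesis
        by (auto simp: flats_Geom)
    qed
    show "down (Geom L) u \<in> flats (Geom L)" if "u \<in> carrier (Geom L)" for u
      using that by (auto simp: down_Geom flats_Geom carrier_Geom join_irreducibles_def)
    show "sdown (Geom L) u \<in> flats (Geom L)" if "u \<in> carrier (Geom L)" for u
      using that lower_cover[of u] by (auto simp: sdown_Geom flats_Geom carrier_Geom)
    show "\<exists>Y\<in>flats (Geom L). X \<prec>\<^bsub>Lat (Geom L)\<^esub> Y \<and> q \<in> Y"
      if q: "q \<in> carrier (Geom L)" and X: "X \<in> flats (Geom L)" and "q \<notin> X"
        and sub: "sdown (Geom L) q \<subseteq> X" for q X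
    proof -
      have qJ: "q \<in> join_irreducibles L"
        using q by (simp add: carrier_Geom)
      then have qL: "q \<in> carrier L"
        by (simp add: join_irreducibles_def)
      obtain x where x: "x \<in> carrier L" "X = irreducibles_below x"
        using X by (auto simp: flats_Geom)
      have not_le: "\<not> q \<sqsubseteq> x"
        using \<open>q \<notin> X\<close> qJ qL by (auto simp: x down_def)
      obtain q' where q': "q' \<prec> q" "q' \<in> carrier L"
        using lower_cover qJ by blast
      have "q' \<sqsubseteq> x"
        using sub irreducibles_below_subset_iff q' x by (simp add: sdown_Geom[OF qJ q'(1)])
      have "q \<sqinter> x = q'"
      proof (rule le_antisym)
        have "q \<sqinter> x \<sqsubset> q"
          using meet_left[of q x] meet_right[of q x] qL x not_le by (auto simp: lless_eq)
        then show "q \<sqinter> x \<sqsubseteq> q'"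
          using less_join_irreducible_iff[OF qJ q'(1)] qL x by simp
        show "q' \<sqsubseteq> q \<sqinter> x"
          using \<open>q' \<sqsubseteq> x\<close> q' qL x less_join_irreducible_iff[OF qJ q'(1) q'(2)]
          by (intro meet_le) (auto simp: lless_eq)
      qed (use q' qL x in simp_all)
      then have "x \<prec> q \<squnion> x"
        using semimodular qL x q' by simp
      then have "X \<prec>\<^bsub>Lat (Geom L)\<^esub> irreducibles_below (q \<squnion> x)"
        unfolding x(2)
        by (rule covered_by_poset_iso[OF poset_iso_Lat_Geom partial_order_axioms partial_order_Lat])
      moreover have "q \<in> irreducibles_below (q \<squnion> x)"
        using qJ qL x join_left by (simp add: down_def)
      ultimately show ?thesis
        by (auto simp: covered_by_Lat)
    qed
  qed
qed

lemma Lat_Geom_isomorphic: "lattice_isomorphic (Lat (Geom L)) L"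
proof -
  have "lattice_iso (Lat (Geom L)) L (inv_into (carrier L) irreducibles_below)"
    using poset_iso_inv[OF poset_iso_Lat_Geom] geometry.lattice_Lat[OF geometry_Geom] lattice_axioms
    by (rule lattice_iso_poset_iso)
  then show ?thesis
    unfolding lattice_isomorphic_def by blast
qed

end

section \<open>The correspondence between semimodular lattices and geometries\<close>

theorem proposition4p3:
  fixes L :: "'a gorder" and G :: "'p geom"
  assumes "semimodular_lattice_finite_length L" and "geometry G"
  shows "geometry (Geom L)
    \<and> semimodular_lattice_finite_length (Lat G)
    \<and> lattice_isomorphic (Lat (Geom L)) L
    \<and> geom_isomorphic (Geom (Lat G)) G"
  using semimodular_lattice_finite_length.geometry_Geom[OF assms(1)]
    geometry.semimodular_lattice_Lat[OF assms(2)]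
    semimodular_lattice_finite_length.Lat_Geom_isomorphic[OF assms(1)]
    geometry.Geom_Lat_isomorphic[OF assms(2)]
  by blast

end
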